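(* For every integer $n\ge 2$, $$DE_{e\ge 2}(n-2)+DE_{\ge 3}(n)=\sum_{i=0}^{n-1}(-1)^i\,reg_{4>1}(n-3i),$$ where $reg_{4>1}(m)$ is the number of $4$-regular partitions of the non-negative integer $m$ with all parts $>1$.
   Context: Notation: $(\alpha;q)_0=1$, $(\alpha;q)_n=\prod_{j=0}^{n-1}(1-\alpha q^j)$, $|q|<1$. The numbers $DE_{e\ge 2}(n)$, $n\ge 0$, are defined by the generating function $\sum_{n\ge 0}DE_{e\ge 2}(n)q^n=\sum_{n\ge 0}\frac{(-q^2;q^2)_n\,q^{4n}}{(q;q^2)_n}$. $DE_{\ge 3}(n)$ is the number of partitions of $n$ in which the even parts are distinct and the largest part is odd and appears at least $3$ times; its generating function is $\sum_{n\ge0}DE_{\ge 3}(n)q^n=\sum_{n\ge 0}\frac{(-q^2;q^2)_n\,q^{3(2n+1)}}{(q;q^2)_{n+1}}$. A $4$-regular partition is a partition with no part divisible by $4$. Convention: $reg_{4>1}(m)=0$ for $m<0$.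
   Formalization: The empty partition is not counted, so reg_{4>1}(0)=0; with the usual value reg_{4>1}(0)=1 the identity fails whenever 3 divides n (for n=3 it reads 1=0). *)

theory Defs
  imports
    "HOL-Library.Multiset"
    "HOL-Computational_Algebra.Formal_Power_Series"
begin

definition qpoch :: "'a::comm_ring_1 \<Rightarrow> 'a \<Rightarrow> nat \<Rightarrow> 'a"
  where "qpoch a q n = (\<Prod>j<n. 1 - a * q ^ j)"

definition DE_e_ge2_term :: "nat \<Rightarrow> rat fps"
  where "DE_e_ge2_term n =
    qpoch (- (fps_X ^ 2)) (fps_X ^ 2) n * fps_X ^ (4 * n) / qpoch fps_X (fps_X ^ 2) n"

text \<open>
  The infinite sum is taken in the topology of the formal power series; it converges by
  \<open>DE_e_ge2_term_sums\<close> below.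
\<close>

definition DE_e_ge2 :: "nat \<Rightarrow> rat"
  where "DE_e_ge2 n = fps_nth (\<Sum>k. DE_e_ge2_term k) n"

text \<open>
  A partition is the multiset of its parts. Partitions are nonempty, so 0 has none, and
  \<open>reg4_gt1 0 = 0\<close> below. With the empty partition counted, that value would be 1 and
  the identity of interest would fail whenever 3 divides \<open>n\<close>: for \<open>n = 3\<close> it would
  read \<open>0 + 1 = 1 - 1\<close>.
\<close>

definition partitions :: "nat \<Rightarrow> nat multiset set"
  where "partitions n = {p. p \<noteq> {#} \<and> (\<forall>k \<in># p. 0 < k) \<and> sum_mset p = n}"

definition DE_ge3 :: "nat \<Rightarrow> nat"
  where "DE_ge3 n = card {p \<in> partitions n.
    (\<forall>k \<in># p. even k \<longrightarrow> count p k = 1) \<and>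
    odd (Max (set_mset p)) \<and> 3 \<le> count p (Max (set_mset p))}"

definition four_regular :: "nat multiset \<Rightarrow> bool"
  where "four_regular p \<longleftrightarrow> (\<forall>k \<in># p. \<not> 4 dvd k)"

definition reg4_gt1 :: "int \<Rightarrow> nat"
  where "reg4_gt1 m =
    (if m < 0 then 0
     else card {p \<in> partitions (nat m). four_regular p \<and> (\<forall>k \<in># p. 1 < k)})"

lemma finite_partitions: "finite (partitions n)"
proof -
  have size_le: "size p \<le> sum_mset p" if "\<forall>k \<in># p. 0 < k" for p :: "nat multiset"
    using that by (induction p) auto
  have "partitions n \<subseteq> mset ` {xs. set xs \<subseteq> {..n} \<and> length xs \<le> n}"
  proof
    fix p assume p: "p \<in> partitions n"
    obtain xs where xs: "p = mset xs" by (metis ex_mset)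
    have "length xs \<le> n"
      using p size_le[of p] by (simp add: partitions_def xs)
    moreover have "set xs \<subseteq> {..n}"
    proof
      fix k assume "k \<in> set xs"
      then have "k \<in># p" by (simp add: xs)
      then have "k \<le> sum_mset p" by (metis multi_member_split sum_mset.add_mset le_add1)
      then show "k \<in> {..n}" using p by (simp add: partitions_def)
    qed
    ultimately show "p \<in> mset ` {xs. set xs \<subseteq> {..n} \<and> length xs \<le> n}"
      using xs by blast
  qed
  then show ?thesis
    by (rule finite_subset) (intro finite_imageI finite_lists_length_le finite_atMost)
qed

lemma qpoch_X_nth_0: "fps_nth (qpoch (fps_X :: 'a::comm_ring_1 fps) (fps_X ^ 2) n) 0 = 1"
  by (induction n) (simp_all add: qpoch_def)

lemma DE_e_ge2_term_nth_eq_0: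
  assumes "m < 4 * n"
  shows "fps_nth (DE_e_ge2_term n) m = 0"
proof -
  let ?d = "qpoch (fps_X :: rat fps) (fps_X ^ 2) n"
  have "DE_e_ge2_term n = qpoch (- (fps_X ^ 2)) (fps_X ^ 2) n * fps_X ^ (4 * n) * inverse ?d"
    unfolding DE_e_ge2_term_def by (rule fps_divide_unit) (simp add: qpoch_X_nth_0)
  also have "\<dots> = fps_X ^ (4 * n) * (qpoch (- (fps_X ^ 2)) (fps_X ^ 2) n * inverse ?d)"
    by (simp only: mult_ac)
  finally show ?thesis
    using assms by (simp add: fps_X_power_mult_nth)
qed

lemma DE_e_ge2_term_sums: "DE_e_ge2_term sums Abs_fps (\<lambda>m. \<Sum>k\<le>m. fps_nth (DE_e_ge2_term k) m)"
  unfolding sums_def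
proof (rule tendsto_fpsI)
  fix m
  have "fps_nth (\<Sum>k<N. DE_e_ge2_term k) m = (\<Sum>k\<le>m. fps_nth (DE_e_ge2_term k) m)"
    if "m < N" for N
    unfolding fps_sum_nth
    by (rule sum.mono_neutral_right) (use that in \<open>auto intro: DE_e_ge2_term_nth_eq_0\<close>)
  then show "\<forall>\<^sub>F N in sequentially. fps_nth (\<Sum>k<N. DE_e_ge2_term k) m =
      fps_nth (Abs_fps (\<lambda>m. \<Sum>k\<le>m. fps_nth (DE_e_ge2_term k) m)) m"
    by (auto intro: eventually_mono[OF eventually_gt_at_top[of m]])
qed

end

theory Submission
  imports Defs
begin

text \<open>
  Write \<open>A\<^sub>k = (-q\<^sup>2;q\<^sup>2)\<^sub>k / (q;q\<^sup>2)\<^sub>k\<close> (\<open>DE_fps k\<close> below), the generating function of partitions into parts at most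
  \<open>2k\<close> whose even parts are distinct. Since
  \<open>u\<^sup>2 + u\<^sup>3 / (1 - u) = u\<^sup>2 / (1 - u)\<close> for \<open>u = q ^ (2k + 1)\<close>, the two series on the left of
  the identity, the first multiplied by \<open>q\<^sup>2\<close>, add up termwise to the single series
  \<open>G = \<Sum>k. A\<^sub>k q ^ (4k + 2) / (1 - q ^ (2k + 1))\<close>.

  This series telescopes after multiplication by \<open>1 + q\<^sup>3\<close>: its \<open>k\<close>-th term is then the difference
  \<open>B\<^sub>k\<^sub>+\<^sub>1 - B\<^sub>k\<close> for \<open>B\<^sub>k = (1 - q + q ^ (2k + 1)) A\<^sub>k\<close> (lemma \<open>telescoping\<close>). Hence
  \<open>(1 + q\<^sup>3) G = (1 - q) A\<^sub>\<infinity> - 1\<close>.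

  As \<open>1 + q ^ (2j) = (1 - q ^ (4j)) / (1 - q ^ (2j))\<close>, the limit \<open>A\<^sub>\<infinity>\<close> is the product of
  \<open>1 / (1 - q ^ k)\<close> over all \<open>k\<close> not divisible by 4. The factor \<open>1 - q\<close> removes the part 1, and
  subtracting 1 removes the empty partition, so \<open>(1 + q\<^sup>3) G\<close> generates the 4-regular partitions
  with parts greater than 1. Dividing by \<open>1 + q\<^sup>3\<close> gives the alternating sum.

  No infinite product is needed: a coefficient of bounded index is the same in \<open>A\<^sub>\<infinity>\<close> and in \<open>A\<^sub>N\<close>
  once \<open>N\<close> is large, and all identities below are between finite sums and products. The
  combinatorial input is \<open>card_restricted_msets\<close>, which turns counting partitions with prescribed
  sets of multiplicities into reading off a coefficient of a finite product.
\<close>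

unbundle fps_syntax

section \<open>Partitions with prescribed multiplicities\<close>

text \<open>
  For \<open>k > 0\<close> this is \<open>\<Sum>c\<in>M. q ^ (c * k)\<close>, where \<open>c\<close> is the number of copies of the part \<open>k\<close>.
\<close>

definition mults_fps :: "nat set \<Rightarrow> nat \<Rightarrow> rat fps"
  where "mults_fps M k = Abs_fps (\<lambda>m. if k dvd m \<and> m div k \<in> M then 1 else 0)"

text \<open>
  The family \<open>M\<close> prescribes multiplicities part by part because distinct parts, unrestricted
  parts and a largest part that occurs at least three times are then all of one form.
\<close>

definition restricted_msets :: "nat set \<Rightarrow> (nat \<Rightarrow> nat set) \<Rightarrow> nat \<Rightarrow> nat multiset set"
  where "restricted_msets S M n =
    {p. set_mset p \<subseteq> S \<and> (\<forall>k\<in>S. count p k \<in> M k) \<and> sum_mset p = n}"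

lemma finite_restricted_msets:
  assumes "0 \<notin> S"
  shows "finite (restricted_msets S M n)"
proof (rule finite_subset)
  show "restricted_msets S M n \<subseteq> insert {#} (partitions n)"
    using assms by (auto simp: restricted_msets_def partitions_def intro!: Nat.gr0I)
  show "finite (insert {#} (partitions n))"
    by (simp add: finite_partitions)
qed

text \<open>
  Deleting all copies of the part \<open>a\<close> is a bijection once their number is fixed; this is the
  combinatorial content of multiplying by one more factor.
\<close>

lemma card_restricted_msets_fibre:
  assumes "a \<notin> S" and "c \<in> M a" and "c * a \<le> n"
  shows "card {p \<in> restricted_msets (insert a S) M n. count p a = c} =
    card (restricted_msets S M (n - c * a))"
proof -
  let ?add = "\<lambda>p. p + replicate_mset c a" and ?del = "filter_mset (\<lambda>x. x \<noteq> a)"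
  let ?F = "{p \<in> restricted_msets (insert a S) M n. count p a = c}"
  have split: "?del p + replicate_mset (count p a) a = p" for p :: "nat multiset"
    by (rule multiset_eqI) auto
  have absent: "count p a = 0" if "set_mset p \<subseteq> S" for p
    using that assms(1) by (auto simp: count_eq_zero_iff)
  have add_del: "\<forall>p\<in>?F. ?add (?del p) = p"
    using split by auto
  have del_add: "\<forall>p\<in>restricted_msets S M (n - c * a). ?del (?add p) = p"
    using assms(1) by (auto simp: restricted_msets_def intro!: multiset_eqI simp: count_eq_zero_iff)
  have del: "?del ` ?F \<subseteq> restricted_msets S M (n - c * a)"
  proof safe
    fix p assume p: "p \<in> restricted_msets (insert a S) M n" and c: "c = count p a"
    have "sum_mset (?del p) + count p a * a = sum_mset p"
      using arg_cong[OF split[of p], of sum_mset] by simp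
    then show "?del p \<in> restricted_msets S M (n - count p a * a)"
      using p assms(1) by (auto simp: restricted_msets_def)
  qed
  have add: "?add ` restricted_msets S M (n - c * a) \<subseteq> ?F"
    using assms absent by (auto simp: restricted_msets_def split: if_splits)
  show ?thesis
    by (rule bij_betw_same_card, rule bij_betw_byWitness [OF add_del del_add del add])
qed

text \<open>
  By induction on \<open>S\<close>. Sorting the multisets by the total \<open>i\<close> that the copies of the new part
  contribute gives exactly the Cauchy product with the new factor.
\<close>

lemma card_restricted_msets:
  assumes "finite S" and "0 \<notin> S"
  shows "of_nat (card (restricted_msets S M n)) = (\<Prod>k\<in>S. mults_fps (M k) k) $ n"
  using assms
proof (induction S arbitrary: n rule: finite_induct)
  case empty
  have "restricted_msets {} M n = (if n = 0 then {{#}} else {})"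
    by (auto simp: restricted_msets_def)
  then show ?case by simp
next
  case (insert a S)
  let ?B = "restricted_msets (insert a S) M n"
  let ?F = "\<lambda>i. {p \<in> ?B. count p a * a = i}"
  have "a > 0" using insert.prems by auto
  have bound: "count p a * a \<le> sum_mset p" for p :: "nat multiset"
  proof -
    have "replicate_mset (count p a) a \<subseteq># p"
      by (simp add: subseteq_mset_def)
    then show ?thesis
      by (metis sum_mset.union subset_mset.add_diff_inverse le_add1 sum_mset_replicate_mset of_nat_id)
  qed
  have fibre: "of_nat (card (?F i)) =
      mults_fps (M a) a $ i * (\<Prod>k\<in>S. mults_fps (M k) k) $ (n - i)" if "i \<le> n" for i
  proof (cases "a dvd i \<and> i div a \<in> M a")
    case True
    then have "?F i = {p \<in> ?B. count p a = i div a}"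
      using \<open>a > 0\<close> by auto
    then have "card (?F i) = card (restricted_msets S M (n - i))"
      using card_restricted_msets_fibre[of a S "i div a" M n] True insert that by simp
    then show ?thesis
      using True insert by (simp add: mults_fps_def)
  next
    case False
    then have "?F i = {}"
      using \<open>a > 0\<close> by (auto simp: restricted_msets_def)
    then show ?thesis
      using False by (simp only: mults_fps_def) auto
  qed
  have "?B = (\<Union>i\<in>{0..n}. ?F i)"
    using bound by (fastforce simp: restricted_msets_def)
  then have "card ?B = card (\<Union>i\<in>{0..n}. ?F i)"
    by simp
  also have "\<dots> = (\<Sum>i=0..n. card (?F i))"
    using finite_restricted_msets[OF insert.prems] by (intro card_UN_disjoint) auto
  finally have "of_nat (card ?B) = (\<Sum>i=0..n. of_nat (card (?F i)) :: rat)"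
    by simp
  then show ?case
    using insert fibre by (simp add: fps_mult_nth)
qed

lemma mults_fps_any:
  assumes "k > 0"
  shows "mults_fps UNIV k = inverse (1 - fps_X ^ k)"
proof -
  have "mults_fps UNIV k * (1 - fps_X ^ k) = 1"
  proof (rule fps_ext)
    fix m
    show "(mults_fps UNIV k * (1 - fps_X ^ k)) $ m = 1 $ m"
      using assms
      by (auto simp: mults_fps_def right_diff_distrib fps_X_power_mult_right_nth
          dvd_minus_self not_less dest: dvd_imp_le)
  qed
  then show ?thesis
    by (metis fps_inverse_unique mult.commute)
qed

lemma mults_fps_at_most_one:
  assumes "k > 0"
  shows "mults_fps {0, 1} k = 1 + fps_X ^ k"
  using assms by (intro fps_ext) (auto simp: mults_fps_def elim!: dvdE)

lemma mults_fps_at_least: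
  assumes "k > 0"
  shows "mults_fps {c..} k = fps_X ^ (c * k) * inverse (1 - fps_X ^ k)"
proof -
  have "mults_fps {c..} k = fps_X ^ (c * k) * mults_fps UNIV k"
  proof (rule fps_ext)
    fix m
    have "k dvd m - c * k \<longleftrightarrow> k dvd m" if "c * k \<le> m"
      using that by (metis dvd_add_right_iff dvd_triv_right le_add_diff_inverse)
    then show "mults_fps {c..} k $ m = (fps_X ^ (c * k) * mults_fps UNIV k) $ m"
      using assms by (auto simp: mults_fps_def fps_X_power_mult_nth less_eq_div_iff_mult_less_eq)
  qed
  then show ?thesis
    using assms by (simp add: mults_fps_any)
qed

section \<open>Partitions with distinct even parts\<close>

definition DE_fps :: "nat \<Rightarrow> rat fps"
  where "DE_fps k = qpoch (- (fps_X ^ 2)) (fps_X ^ 2) k * inverse (qpoch fps_X (fps_X ^ 2) k)"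

lemma one_minus_X_power_inverse:
  "k > 0 \<Longrightarrow> (1 - fps_X ^ k) * inverse (1 - fps_X ^ k :: rat fps) = 1"
  by (intro inverse_mult_eq_1') simp

lemma DE_fps_0: "DE_fps 0 = 1"
  by (simp add: DE_fps_def qpoch_def)

lemma DE_fps_Suc:
  "DE_fps (Suc k) = DE_fps k * (1 + fps_X ^ (2 * k + 2)) * inverse (1 - fps_X ^ (2 * k + 1))"
proof -
  have "(fps_X ^ 2) ^ k = (fps_X ^ (2 * k) :: rat fps)"
    by (simp add: power_mult)
  then show ?thesis
    unfolding DE_fps_def qpoch_def prod.lessThan_Suc fps_inverse_mult
    by (simp add: power_add power2_eq_square [of fps_X] mult_ac del: power_mult)
qed

lemma DE_fps_eq_prod:
  "DE_fps k = (\<Prod>j=1..2 * k. mults_fps (if even j then {0, 1} else UNIV) j)"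
proof (induction k)
  case 0
  show ?case by (simp add: DE_fps_0)
next
  case (Suc k)
  have "{1..2 * Suc k} = insert (2 * k + 2) (insert (2 * k + 1) {1..2 * k})"
    by auto
  then show ?case
    by (simp add: Suc DE_fps_Suc mults_fps_any mults_fps_at_most_one mult_ac del: One_nat_def)
qed

text \<open>
  The recurrence \<open>(1 - q ^ (2k + 1)) A\<^sub>k\<^sub>+\<^sub>1 = (1 + q ^ (2k + 2)) A\<^sub>k\<close> makes
  \<open>(a + b q ^ (2k)) A\<^sub>k\<close> a natural candidate for an antidifference. With
  \<open>x = q ^ (2k)\<close>, its difference is \<open>A\<^sub>k / (1 - q x)\<close> times a polynomial in \<open>x\<close> whose linear
  coefficient \<open>a q (1 + q) - b (1 - q\<^sup>2)\<close> vanishes for \<open>a = 1 - q\<close> and \<open>b = q\<close>; what remains is \<open>(1 + q\<^sup>3) q ^ (4k + 2) A\<^sub>k / (1 - q ^ (2k + 1))\<close>.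
\<close>

lemma telescoping:
  "(1 + fps_X ^ 3) * (\<Sum>k<N. DE_fps k * fps_X ^ (4 * k + 2) * inverse (1 - fps_X ^ (2 * k + 1))) =
    (1 - fps_X + fps_X ^ (2 * N + 1)) * DE_fps N - 1"
proof (induction N)
  case 0
  show ?case by (simp add: DE_fps_0)
next
  case (Suc N)
  let ?X = "fps_X :: rat fps"
  define I where "I = inverse (1 - ?X ^ (2 * N + 1))"
  define x where "x = ?X ^ N"
  have I: "(1 - ?X * x^2) * I = 1"
    using one_minus_X_power_inverse[of "2 * N + 1"]
    by (simp add: I_def x_def power_mult [symmetric] mult.commute)
  have "((1 - ?X + ?X * x^2) * DE_fps N - 1) + (1 + ?X ^ 3) * (DE_fps N * (?X^2 * x^4) * I)
    = (1 - ?X + ?X ^ 3 * x^2) * (DE_fps N * (1 + ?X^2 * x^2) * I) - 1"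
    using I by algebra
  moreover have "?X ^ (4 * N + 2) = ?X^2 * x^4" "?X ^ (2 * N + 1) = ?X * x^2"
    "?X ^ (2 * N + 2) = ?X^2 * x^2" "?X ^ (2 * Suc N + 1) = ?X ^ 3 * x^2"
    by (simp_all add: x_def power_mult [symmetric] power_add mult_ac eval_nat_numeral)
  ultimately show ?case
    unfolding sum.lessThan_Suc DE_fps_Suc I_def [symmetric]
    by (subst distrib_left) (simp only: Suc)
qed

text \<open>
  The partitions are sorted by their largest part \<open>2k + 1\<close>. It is at most \<open>n\<close>, so that
  every \<open>N > n\<close> catches all of them.
\<close>

lemma of_nat_DE_ge3:
  assumes "n < N"
  shows "of_nat (DE_ge3 n) =
    (\<Sum>k<N. DE_fps k * fps_X ^ (6 * k + 3) * inverse (1 - fps_X ^ (2 * k + 1))) $ n"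
proof -
  define M where "M k j = (if j = 2 * k + 1 then {3::nat..} else if even j then {0, 1} else UNIV)"
    for k j :: nat
  let ?B = "\<lambda>k. restricted_msets {1..2 * k + 1} (M k) n"
  have gf: "of_nat (card (?B k)) =
      (DE_fps k * fps_X ^ (6 * k + 3) * inverse (1 - fps_X ^ (2 * k + 1))) $ n" for k
  proof -
    have "{1..2 * k + 1} = insert (2 * k + 1) {1..2 * k}" by auto
    moreover have "(\<Prod>j=1..2 * k. mults_fps (M k j) j) = DE_fps k"
      unfolding DE_fps_eq_prod by (rule prod.cong) (auto simp: M_def)
    ultimately have "(\<Prod>j=1..2 * k + 1. mults_fps (M k j) j) =
        DE_fps k * mults_fps {3..} (2 * k + 1)"
      by (simp add: M_def mult_ac)
    then show ?thesis
      by (subst card_restricted_msets) (simp_all add: mults_fps_at_least algebra_simps)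
  qed
  have max: "Max (set_mset p) = 2 * k + 1" if "p \<in> ?B k" for p k
    using that by (intro Max_eqI) (force simp: restricted_msets_def M_def simp flip: count_greater_zero_iff)+
  have "{p \<in> partitions n. (\<forall>k \<in># p. even k \<longrightarrow> count p k = 1) \<and>
      odd (Max (set_mset p)) \<and> 3 \<le> count p (Max (set_mset p))} = (\<Union>k<N. ?B k)" (is "?D = _")
  proof (intro equalityI subsetI)
    fix p assume p: "p \<in> ?D"
    then have "p \<noteq> {#}" by (simp add: partitions_def)
    define m where "m = Max (set_mset p)"
    have "m \<in># p" using \<open>p \<noteq> {#}\<close> by (simp add: m_def)
    obtain k where k: "m = 2 * k + 1"
      using p by (auto simp: m_def elim: oddE)
    have "m \<le> n"
      using p \<open>m \<in># p\<close> by (auto simp: partitions_def dest!: multi_member_split)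
    have le: "j \<le> m" if "j \<in># p" for j
      using that by (simp add: m_def)
    have "p \<in> ?B k"
      unfolding restricted_msets_def
    proof (intro CollectI conjI ballI)
      show "set_mset p \<subseteq> {1..2 * k + 1}"
        using p le by (auto simp: partitions_def k Suc_le_eq)
      show "count p j \<in> M k j" for j
        using p k by (cases "j \<in># p") (auto simp: M_def m_def [symmetric] not_in_iff)
      show "sum_mset p = n"
        using p by (simp add: partitions_def)
    qed
    then show "p \<in> (\<Union>k<N. ?B k)"
      using \<open>m \<le> n\<close> k assms by auto
  next
    fix p assume "p \<in> (\<Union>k<N. ?B k)"
    then obtain k where p: "p \<in> ?B k" by auto
    then have three: "3 \<le> count p (2 * k + 1)"
      by (force simp: restricted_msets_def M_def)
    moreover have "count p j = 1" if "j \<in># p" "even j" for j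
    proof -
      have "count p j \<in> M k j" "j \<noteq> 2 * k + 1"
        using p that by (auto simp: restricted_msets_def)
      then show ?thesis
        using that by (auto simp: M_def simp flip: count_greater_zero_iff)
    qed
    ultimately show "p \<in> ?D"
      using p max[OF p] by (auto simp: restricted_msets_def partitions_def)
  qed
  then have "DE_ge3 n = card (\<Union>k<N. ?B k)"
    by (simp add: DE_ge3_def)
  also have "\<dots> = (\<Sum>k<N. card (?B k))"
  proof (intro card_UN_disjoint ballI impI)
    show "?B i \<inter> ?B j = {}" if "i \<noteq> j" for i j
      using max[of _ i] max[of _ j] that by force
  qed (simp_all add: finite_restricted_msets)
  finally show ?thesis
    by (simp only: of_nat_sum gf fps_sum_nth)
qed

lemma DE_e_ge2_eq_sum:
  assumes "n < N"
  shows "DE_e_ge2 n = (\<Sum>k<N. DE_fps k * fps_X ^ (4 * k)) $ n"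
proof -
  have term_eq: "DE_e_ge2_term k = DE_fps k * fps_X ^ (4 * k)" for k
    unfolding DE_e_ge2_term_def DE_fps_def
    by (subst fps_divide_unit) (simp_all add: qpoch_X_nth_0 mult_ac)
  have "DE_e_ge2 n = (\<Sum>k\<le>n. DE_e_ge2_term k $ n)"
    unfolding DE_e_ge2_def sums_unique[OF DE_e_ge2_term_sums, symmetric] by simp
  also have "\<dots> = (\<Sum>k<N. DE_e_ge2_term k $ n)"
    by (rule sum.mono_neutral_left) (use assms in \<open>auto intro: DE_e_ge2_term_nth_eq_0\<close>)
  finally show ?thesis by (simp add: term_eq fps_sum_nth)
qed

section \<open>4-regular partitions\<close>

text \<open>
  The hypothesis \<open>m > 0\<close> excludes the empty partition, which contributes 1 to the constant
  coefficient of the product but is not counted by \<open>reg4_gt1\<close>.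
\<close>

lemma of_nat_reg4_gt1:
  assumes "m > 0" "m \<le> L"
  shows "of_nat (reg4_gt1 (int m)) =
    (\<Prod>k\<in>{k \<in> {2..L}. \<not> 4 dvd k}. inverse (1 - fps_X ^ k) :: rat fps) $ m"
proof -
  let ?S = "{k \<in> {2..L}. \<not> 4 dvd k}"
  have le: "j \<le> sum_mset p" if "j \<in># p" for j and p :: "nat multiset"
    using that by (auto dest!: multi_member_split)
  have "{p \<in> partitions m. four_regular p \<and> (\<forall>k \<in># p. 1 < k)} =
      restricted_msets ?S (\<lambda>_. UNIV) m"
    using assms le by (fastforce simp: restricted_msets_def partitions_def four_regular_def)
  then have "of_nat (reg4_gt1 (int m)) = (\<Prod>k\<in>?S. mults_fps UNIV k) $ m"
    by (simp add: reg4_gt1_def card_restricted_msets)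
  then show ?thesis
    by (simp add: mults_fps_any)
qed


lemma fps_prod_nth_0: "(\<Prod>k\<in>S. f k) $ 0 = (\<Prod>k\<in>S. f k $ 0)"
  for f :: "'b \<Rightarrow> 'a::comm_ring_1 fps"
  by (induction S rule: infinite_finite_induct) simp_all

lemma prod_one_minus_X_power_nth:
  fixes f :: "rat fps"
  assumes "finite S" and "\<And>k. k \<in> S \<Longrightarrow> m < k"
  shows "(f * (\<Prod>k\<in>S. 1 - fps_X ^ k)) $ m = f $ m"
  using assms
proof (induction S arbitrary: f rule: finite_induct)
  case empty
  show ?case by simp
next
  case (insert a S)
  have "(f * (\<Prod>k\<in>insert a S. 1 - fps_X ^ k)) $ m =
      (f * (1 - fps_X ^ a) * (\<Prod>k\<in>S. 1 - fps_X ^ k)) $ m"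
    using insert.hyps by (simp add: mult.assoc)
  also have "\<dots> = (f * (1 - fps_X ^ a)) $ m"
    using insert by blast
  also have "\<dots> = f $ m"
    using insert.prems by (simp add: right_diff_distrib fps_X_power_mult_right_nth)
  finally show ?case .
qed

text \<open>
  Multiplying the finite product \<open>A\<^sub>N\<close> and the finite product for 4-regular partitions by
  \<open>(q;q)\<^sub>2\<^sub>N\<close> and \<open>(q;q)\<^sub>4\<^sub>N\<close>, respectively, yields the same \<open>(q\<^sup>4;q\<^sup>4)\<^sub>N\<close>. The bound \<open>4N\<close>
  in the second product is chosen for this.
\<close>

lemma DE_fps_times_prod:
  "DE_fps N * (\<Prod>k=1..2 * N. 1 - fps_X ^ k) = (\<Prod>j=1..N. 1 - fps_X ^ (4 * j))"
proof (induction N)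
  case 0
  show ?case by (simp add: DE_fps_0)
next
  case (Suc N)
  have "{1..2 * Suc N} = insert (2 * N + 2) (insert (2 * N + 1) {1..2 * N})"
    by auto
  then have "DE_fps (Suc N) * (\<Prod>k=1..2 * Suc N. 1 - fps_X ^ k) =
      (DE_fps N * (\<Prod>k=1..2 * N. 1 - fps_X ^ k)) *
      ((1 - fps_X ^ (2 * N + 1)) * inverse (1 - fps_X ^ (2 * N + 1))) *
      ((1 + fps_X ^ (2 * N + 2)) * (1 - fps_X ^ (2 * N + 2)))"
    by (simp add: DE_fps_Suc mult_ac del: power_Suc)
  also have "(1 + fps_X ^ (2 * N + 2)) * (1 - fps_X ^ (2 * N + 2)) = (1 - fps_X ^ (4 * Suc N) :: rat fps)"
    by (simp add: algebra_simps flip: power_add del: power_Suc)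
  also have "(1 - fps_X ^ (2 * N + 1)) * inverse (1 - fps_X ^ (2 * N + 1)) = (1 :: rat fps)"
    by (rule one_minus_X_power_inverse) simp
  finally show ?case
    by (simp only: Suc mult_1_right) simp
qed

lemma four_regular_times_prod:
  "(\<Prod>k\<in>{k \<in> {1..4 * N}. \<not> 4 dvd k}. inverse (1 - fps_X ^ k)) * (\<Prod>k=1..4 * N. 1 - fps_X ^ k) =
    (\<Prod>j=1..N. 1 - fps_X ^ (4 * j) :: rat fps)"
proof -
  let ?S = "{k \<in> {1..4 * N}. \<not> 4 dvd k}" and ?T = "(\<lambda>j. 4 * j) ` {1..N}"
  have "{1..4 * N} = ?S \<union> ?T"
    by (auto elim!: dvdE)
  then have "(\<Prod>k=1..4 * N. 1 - fps_X ^ k) = (\<Prod>k\<in>?S \<union> ?T. 1 - fps_X ^ k :: rat fps)"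
    by (rule arg_cong)
  also have "\<dots> = (\<Prod>k\<in>?S. 1 - fps_X ^ k) * (\<Prod>k\<in>?T. 1 - fps_X ^ k)"
    by (rule prod.union_disjoint) auto
  also have "(\<Prod>k\<in>?T. 1 - fps_X ^ k) = (\<Prod>j=1..N. 1 - fps_X ^ (4 * j) :: rat fps)"
    by (subst prod.reindex) (auto simp: inj_on_def)
  finally have "(\<Prod>k\<in>?S. inverse (1 - fps_X ^ k)) * (\<Prod>k=1..4 * N. 1 - fps_X ^ k) =
      (\<Prod>k\<in>?S. (1 - fps_X ^ k) * inverse (1 - fps_X ^ k)) * (\<Prod>j=1..N. 1 - fps_X ^ (4 * j) :: rat fps)"
    by (simp only: prod.distrib mult_ac)
  also have "(\<Prod>k\<in>?S. (1 - fps_X ^ k) * inverse (1 - fps_X ^ k :: rat fps)) = 1"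
    by (rule prod.neutral) (auto intro!: one_minus_X_power_inverse)
  finally show ?thesis by simp
qed

text \<open>
  The two products therefore differ only by \<open>(q;q)\<^sub>4\<^sub>N / (q;q)\<^sub>2\<^sub>N\<close>, which is 1 up to and
  including the exponent \<open>2N\<close>.
\<close>

lemma DE_fps_eq_four_regular:
  "DE_fps N = (\<Prod>k\<in>{k \<in> {1..4 * N}. \<not> 4 dvd k}. inverse (1 - fps_X ^ k)) *
    (\<Prod>k\<in>{2 * N<..4 * N}. 1 - fps_X ^ k)" (is "_ = ?R * ?E")
proof -
  let ?D = "\<Prod>k=1..2 * N. 1 - fps_X ^ k :: rat fps"
  have "{1..4 * N} = {1..2 * N} \<union> {2 * N<..4 * N}" by auto
  then have "(\<Prod>k=1..4 * N. 1 - fps_X ^ k) = (\<Prod>k\<in>{1..2 * N} \<union> {2 * N<..4 * N}. 1 - fps_X ^ k :: rat fps)"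
    by (rule arg_cong)
  also have "\<dots> = ?D * ?E"
    by (rule prod.union_disjoint) auto
  finally have "(\<Prod>k=1..4 * N. 1 - fps_X ^ k) = ?D * ?E" .
  then have "DE_fps N * ?D = ?R * ?E * ?D"
    using DE_fps_times_prod[of N] four_regular_times_prod[of N] by (simp add: mult_ac)
  moreover have "?D $ 0 = 1"
    unfolding fps_prod_nth_0 by (rule prod.neutral) simp
  then have "?D \<noteq> 0" by (metis fps_zero_nth zero_neq_one)
  ultimately show ?thesis by simp
qed

lemma of_nat_reg4_gt1_eq_DE_fps:
  assumes "m \<le> 2 * N" "N > 0"
  shows "of_nat (reg4_gt1 (int m)) = ((1 - fps_X) * DE_fps N - 1) $ m"
proof -
  let ?R = "\<Prod>k\<in>{k \<in> {2..4 * N}. \<not> 4 dvd k}. inverse (1 - fps_X ^ k) :: rat fps"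
  have "{k \<in> {1..4 * N}. \<not> 4 dvd k} = insert 1 {k \<in> {2..4 * N}. \<not> 4 dvd k}"
    using assms by (auto simp: Suc_le_eq)
  then have "(1 - fps_X) * DE_fps N =
      ((1 - fps_X) * inverse (1 - fps_X)) * ?R * (\<Prod>k\<in>{2 * N<..4 * N}. 1 - fps_X ^ k)"
    by (simp add: DE_fps_eq_four_regular mult_ac)
  also have "(1 - fps_X) * inverse (1 - fps_X) = (1 :: rat fps)"
    using one_minus_X_power_inverse[of 1] by simp
  finally have "((1 - fps_X) * DE_fps N) $ m = ?R $ m"
    unfolding mult_1_left by (simp only:) (rule prod_one_minus_X_power_nth; use assms in auto)
  moreover have "of_nat (reg4_gt1 (int m)) = (?R - 1) $ m"
  proof (cases "m = 0")
    case True
    have "sum_mset p \<noteq> 0" if "p \<noteq> {#}" "\<forall>k \<in># p. 1 < k" for p :: "nat multiset"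
      using that by (cases p) auto
    then have empty: "{p \<in> partitions 0. four_regular p \<and> (\<forall>k \<in># p. 1 < k)} = {}"
      unfolding partitions_def by blast
    have "reg4_gt1 0 = card {p \<in> partitions 0. four_regular p \<and> (\<forall>k \<in># p. 1 < k)}"
      by (simp add: reg4_gt1_def)
    then have "reg4_gt1 0 = 0"
      unfolding empty by simp
    moreover have "?R $ 0 = 1"
      by (auto simp: fps_prod_nth_0 intro!: prod.neutral)
    ultimately show ?thesis using True by simp
  next
    case False
    then show ?thesis
      using assms of_nat_reg4_gt1[of m "4 * N"] by simp
  qed
  ultimately show ?thesis by simp
qed

section \<open>The alternating sum\<close>

text \<open>
  The right-hand side unfolds the recurrence \<open>G\<^sub>m = r\<^sub>m - G\<^sub>m\<^sub>-\<^sub>3\<close>. The number \<open>K\<close> of summands may be any number with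
  \<open>m \<le> 3K\<close>: the summands beyond \<open>m / 3\<close> vanish because \<open>r\<close> is 0 at nonpositive arguments.
  Thus \<open>K\<close> can serve as the induction variable, with \<open>m\<close> replaced by \<open>m - 3\<close> in each step.
\<close>

lemma alternating_sum_of_one_plus_X_cube:
  fixes G :: "rat fps" and r :: "int \<Rightarrow> rat"
  assumes r: "\<And>m. m \<le> n \<Longrightarrow> ((1 + fps_X ^ 3) * G) $ m = r (int m)"
    and nonpos: "\<And>z. z \<le> 0 \<Longrightarrow> r z = 0"
  shows "m \<le> n \<Longrightarrow> m \<le> 3 * K \<Longrightarrow> G $ m = (\<Sum>i<K. (- 1) ^ i * r (int m - 3 * int i))"
proof (induction K arbitrary: m)
  case 0
  then show ?case using r[of 0] nonpos[of 0] by (simp add: distrib_right fps_X_power_mult_nth)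
next
  case (Suc K)
  have "(\<Sum>i<Suc K. (- 1) ^ i * r (int m - 3 * int i)) =
      r (int m) - (\<Sum>i<K. (- 1) ^ i * r (int m - 3 - 3 * int i))"
    by (simp only: sum.lessThan_Suc_shift) (simp add: sum_negf algebra_simps)
  moreover have "r (int m) = G $ m + (if m < 3 then 0 else G $ (m - 3))"
    using r[OF Suc.prems(1)] by (simp add: distrib_right fps_X_power_mult_nth)
  moreover have "(\<Sum>i<K. (- 1) ^ i * r (int m - 3 - 3 * int i)) = (if m < 3 then 0 else G $ (m - 3))"
    using Suc.IH[of "m - 3"] Suc.prems by (auto simp: nonpos of_nat_diff intro!: sum.neutral)
  ultimately show ?case by simp
qed

theorem theorem7:
  fixes n :: nat
  assumes "n \<ge> 2"
  shows "DE_e_ge2 (n - 2) + of_nat (DE_ge3 n) =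
    (\<Sum>i = 0..n - 1. (- 1) ^ i * of_nat (reg4_gt1 (int n - 3 * int i)))"
proof -
  \<comment> \<open>With \<open>N > n\<close>, neither the terms cut off from \<open>G\<close> nor the boundary term
    \<open>q ^ (2N + 1) A\<^sub>N\<close> of the telescoping sum affect coefficients up to \<open>n\<close>.\<close>
  define N where "N = Suc n"
  define I where "I k = inverse (1 - fps_X ^ (2 * k + 1) :: rat fps)" for k
  define G where "G = (\<Sum>k<N. DE_fps k * fps_X ^ (4 * k + 2) * I k)"
  have "fps_X ^ 2 * (DE_fps k * fps_X ^ (4 * k)) + DE_fps k * fps_X ^ (6 * k + 3) * I k =
      DE_fps k * fps_X ^ (4 * k + 2) * I k" for k
  proof -
    define u :: "rat fps" where "u = fps_X ^ (2 * k + 1)"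
    have "fps_X ^ (4 * k + 2) = u ^ 2" "fps_X ^ (6 * k + 3) = u ^ 3"
      "fps_X ^ 2 * (DE_fps k * fps_X ^ (4 * k)) = DE_fps k * u ^ 2"
      by (simp_all add: u_def algebra_simps flip: power_mult power_add)
    moreover have "(1 - u) * I k = 1"
      unfolding u_def I_def by (rule one_minus_X_power_inverse) simp
    then have "DE_fps k * u ^ 2 + DE_fps k * u ^ 3 * I k = DE_fps k * u ^ 2 * I k"
      by algebra
    ultimately show ?thesis by (simp only:)
  qed
  then have "G = fps_X ^ 2 * (\<Sum>k<N. DE_fps k * fps_X ^ (4 * k)) +
      (\<Sum>k<N. DE_fps k * fps_X ^ (6 * k + 3) * I k)"
    by (simp add: G_def sum_distrib_left flip: sum.distrib)
  then have "G $ n = DE_e_ge2 (n - 2) + of_nat (DE_ge3 n)"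
    using assms DE_e_ge2_eq_sum[of "n - 2" N] of_nat_DE_ge3[of n N]
    by (simp add: N_def I_def fps_X_power_mult_nth)
  moreover have "((1 + fps_X ^ 3) * G) $ m = of_nat (reg4_gt1 (int m))" if "m \<le> n" for m
  proof -
    have "(fps_X ^ (2 * N + 1) * DE_fps N) $ m = 0"
      unfolding fps_X_power_mult_nth using that by (simp add: N_def)
    moreover have "(1 + fps_X ^ 3) * G = ((1 - fps_X) * DE_fps N - 1) + fps_X ^ (2 * N + 1) * DE_fps N"
      unfolding G_def I_def telescoping by (simp add: algebra_simps)
    ultimately show ?thesis
      using of_nat_reg4_gt1_eq_DE_fps[of m N] that by (simp add: N_def)
  qed
  moreover have "of_nat (reg4_gt1 z) = (0 :: rat)" if "z \<le> 0" for z
    using that of_nat_reg4_gt1_eq_DE_fps[of 0 1]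
    by (cases "z = 0") (auto simp: reg4_gt1_def DE_fps_def qpoch_def)
  ultimately have "DE_e_ge2 (n - 2) + of_nat (DE_ge3 n) =
      (\<Sum>i<n. (- 1) ^ i * of_nat (reg4_gt1 (int n - 3 * int i)))"
    using alternating_sum_of_one_plus_X_cube[of n G "\<lambda>z. of_nat (reg4_gt1 z)" n n] by simp
  moreover have "{0..n - 1} = {..<n}"
    using assms by auto
  ultimately show ?thesis by simp
qed

end
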